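(* Let $j\ge i\ge1$ be integers and assume $j-i$ is even. Let $\bm a=(a_1,\ldots,a_i)$ and $\bm b=(b_1,\ldots,b_j)$ be real vectors satisfying $0<b_r<a_r$ for $1\le r\le i$ and $b_r>0$ for $i<r\le j$. Then $$\mathfrak{H}_{-1}\begin{bmatrix}\bm b\\\bm a\end{bmatrix}=\mu_X,$$ i.e. $\mathfrak{H}_{-1}\begin{bmatrix}\bm b\\\bm a\end{bmatrix}(n)=\mathbb{E}[X^n]$ for all $n\in\mathbb{N}$, where $X$ is a random variable with law $$\operatorname{Law}(X)=\operatorname{Beta}(b_1,a_1-b_1)\boxtimes_{\mathrm{cl}}\cdots\boxtimes_{\mathrm{cl}}\operatorname{Beta}(b_i,a_i-b_i)\boxtimes_{\mathrm{cl}}\operatorname{Gamma}(b_{i+1},1)\boxtimes_{\mathrm{cl}}\cdots\boxtimes_{\mathrm{cl}}\operatorname{Gamma}(b_j,1).$$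
   Context: $\mathbb{N}=\{0,1,2,\dots\}$. $(c)_{\underline{0}}=1$, $(c)_{\underline{n}}=c(c-1)\cdots(c-n+1)$ for $n\ge1$; for a vector $\bm c=(c_1,\dots,c_k)$, $(\bm c)_{\underline{n}}=\prod_{r=1}^k(c_r)_{\underline{n}}$, and $t\bm c=(tc_1,\dots,tc_k)$. The hypergeometric Hurwitz series is the map $\mathbb{N}\to\mathbb{C}$ given by $$\mathfrak{H}_t\begin{bmatrix}\bm b\\\bm a\end{bmatrix}(n)=(-1)^n\frac{(t)_{\underline{n}}(t\bm b)_{\underline{n}}}{n!\,(t\bm a)_{\underline{n}}},$$ here used with $t=-1$. For a random variable $X$ with moments of every order, $\mu_X(n)=\mathbb{E}[X^n]$. $\boxtimes_{\mathrm{cl}}$ is classical multiplicative convolution: the law of the product of independent positive random variables with the given laws. $\operatorname{Gamma}(b,1)$ has shape $b$ and scale $1$. *)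

theory Defs
  imports "HOL-Probability.Probability"
begin

definition falling :: "'a::comm_ring_1 \<Rightarrow> nat \<Rightarrow> 'a" where
  "falling c n = (\<Prod>k<n. c - of_nat k)"

definition falling_vec :: "'a::comm_ring_1 list \<Rightarrow> nat \<Rightarrow> 'a" where
  "falling_vec cs n = (\<Prod>c\<leftarrow>cs. falling c n)"

text \<open>The hypergeometric Hurwitz series, with upper parameters \<open>bs\<close> and lower parameters \<open>as\<close>.
  It is meaningful only if \<open>falling_vec (map ((*) t) as) n\<close> never vanishes (as is the case for
  \<open>t = -1\<close> and positive \<open>as\<close>); otherwise the convention \<open>x / 0 = 0\<close> applies.\<close>

definition hurwitz_series :: "complex \<Rightarrow> complex list \<Rightarrow> complex list \<Rightarrow> nat \<Rightarrow> complex" where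
  "hurwitz_series t bs as n =
     (- 1) ^ n * (falling t n * falling_vec (map ((*) t) bs) n)
       / (fact n * falling_vec (map ((*) t) as) n)"

text \<open>The Bochner integral of a non-integrable function is 0, so the value of \<open>moment_seq\<close> is
  only meaningful together with \<open>has_all_moments\<close>.\<close>

definition has_all_moments :: "'m measure \<Rightarrow> ('m \<Rightarrow> real) \<Rightarrow> bool" where
  "has_all_moments M X \<longleftrightarrow> (\<forall>n. integrable M (\<lambda>\<omega>. X \<omega> ^ n))"

definition moment_seq :: "'m measure \<Rightarrow> ('m \<Rightarrow> real) \<Rightarrow> nat \<Rightarrow> complex" where
  "moment_seq M X n = complex_of_real (\<integral>\<omega>. X \<omega> ^ n \<partial>M)"

definition beta_law :: "real \<Rightarrow> real \<Rightarrow> real measure" where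
  "beta_law p q = density lborel (\<lambda>x. ennreal
     (if 0 < x \<and> x < 1 then x powr (p - 1) * (1 - x) powr (q - 1) / Beta p q else 0))"

definition gamma_law :: "real \<Rightarrow> real \<Rightarrow> real measure" where
  "gamma_law k \<theta> = density lborel (\<lambda>x. ennreal
     (if 0 < x then x powr (k - 1) * exp (- x / \<theta>) / (Gamma k * \<theta> powr k)
      else 0))"

text \<open>Classical multiplicative convolution. The two coordinates of the product space are the
  independent random variables; see \<open>distr_mult_indep\<close> for arbitrary ones.\<close>

definition mult_conv :: "real measure \<Rightarrow> real measure \<Rightarrow> real measure" where
  "mult_conv \<mu> \<nu> = distr (\<mu> \<Otimes>\<^sub>M \<nu>) borel (\<lambda>(x, y). x * y)"

text \<open>\<open>\<mu>\<^sub>1 \<boxtimes> \<dots> \<boxtimes> \<mu>\<^sub>k\<close>, bracketed to the left, for a nonempty list of laws.\<close>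

definition mult_conv_list :: "real measure list \<Rightarrow> real measure" where
  "mult_conv_list \<mu>s = foldl mult_conv (hd \<mu>s) (tl \<mu>s)"

definition beta_gamma_law :: "real list \<Rightarrow> real list \<Rightarrow> real measure" where
  "beta_gamma_law as bs = mult_conv_list
     (map (\<lambda>r. beta_law (bs ! r) (as ! r - bs ! r)) [0..<length as] @
      map (\<lambda>r. gamma_law (bs ! r) 1) [length as..<length bs])"

lemma (in prob_space) distr_mult_indep:
  assumes "indep_var borel X borel Y"
  shows "distr M borel (\<lambda>\<omega>. X \<omega> * Y \<omega> :: real) = mult_conv (distr M borel X) (distr M borel Y)"
proof -
  have m [measurable]: "X \<in> borel_measurable M" "Y \<in> borel_measurable M"
    using assms by (auto simp: indep_var_distribution_eq)
  have "distr M borel X \<Otimes>\<^sub>M distr M borel Y = distr M (borel \<Otimes>\<^sub>M borel) (\<lambda>\<omega>. (X \<omega>, Y \<omega>))"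
    using assms by (simp add: indep_var_distribution_eq)
  then show ?thesis
    unfolding mult_conv_def by (simp add: distr_distr comp_def)
qed

text \<open>The laws are probability measures on the Borel sets, so that random variables with
  law \<open>beta_gamma_law as bs\<close> exist.\<close>

lemma prob_space_beta_law:
  assumes "p > 0" "q > 0"
  shows "prob_space (beta_law p q)"
proof
  let ?f = "\<lambda>x::real. if 0 < x \<and> x < 1
    then x powr (p - 1) * (1 - x) powr (q - 1) / Beta p q else 0"
  have B: "Beta p q > 0"
    using assms by (simp add: Beta_def Gamma_real_pos)
  have "((\<lambda>x. x powr (p - 1) * (1 - x) powr (q - 1) / Beta p q) has_integral 1) {0<..<1}"
    using has_integral_divide[OF has_integral_Beta_real[OF assms], of "Beta p q"] B
    by (simp add: has_integral_Icc_iff_Ioo)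
  from nn_integral_has_integral_lebesgue[OF _ this] B
  have "(\<integral>\<^sup>+x. ennreal (indicator {0<..<1} x *
           (x powr (p - 1) * (1 - x) powr (q - 1) / Beta p q)) \<partial>lborel) = 1"
    by simp
  also have "(\<lambda>x. ennreal (indicator {0<..<1} x *
           (x powr (p - 1) * (1 - x) powr (q - 1) / Beta p q))) = (\<lambda>x. ennreal (?f x))"
    by (auto simp: indicator_def)
  finally show "emeasure (beta_law p q) (space (beta_law p q)) = 1"
    by (simp add: beta_law_def emeasure_density)
qed

lemma prob_space_gamma_law:
  assumes "s > 0"
  shows "prob_space (gamma_law s 1)"
proof
  let ?f = "\<lambda>x::real. if 0 < x
    then x powr (s - 1) * exp (- x / 1) / (Gamma s * 1 powr s) else 0"
  have G: "Gamma s > 0"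
    using assms by (rule Gamma_real_pos)
  have "((\<lambda>x. x powr (s - 1) / exp x / Gamma s) has_integral 1) {0..}"
    using has_integral_divide[OF Gamma_integral_real[OF assms], of "Gamma s"] G by simp
  from nn_integral_has_integral_lebesgue[OF _ this] G
  have "(\<integral>\<^sup>+x. ennreal (indicator {0..} x * (x powr (s - 1) / exp x / Gamma s)) \<partial>lborel) = 1"
    by simp
  also have "(\<lambda>x. ennreal (indicator {0..} x * (x powr (s - 1) / exp x / Gamma s)))
           = (\<lambda>x. ennreal (?f x))"
    by (auto simp: indicator_def exp_minus field_simps)
  finally show "emeasure (gamma_law s 1) (space (gamma_law s 1)) = 1"
    by (simp add: gamma_law_def emeasure_density)
qed

lemma prob_space_mult_conv:
  assumes "prob_space \<mu>" "prob_space \<nu>" "sets \<mu> = sets borel" "sets \<nu> = sets borel"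
  shows "prob_space (mult_conv \<mu> \<nu>)"
proof -
  interpret \<mu>: prob_space \<mu> by fact
  interpret \<nu>: prob_space \<nu> by fact
  interpret pair_prob_space \<mu> \<nu> ..
  have [measurable_cong]: "sets \<mu> = sets borel" "sets \<nu> = sets borel" by fact+
  show ?thesis
    unfolding mult_conv_def by (rule prob_space_distr) measurable
qed

lemma sets_beta_law: "sets (beta_law p q) = sets borel"
  by (simp add: beta_law_def)

lemma sets_gamma_law: "sets (gamma_law k \<theta>) = sets borel"
  by (simp add: gamma_law_def)

lemma sets_mult_conv: "sets (mult_conv \<mu> \<nu>) = sets borel"
  by (simp add: mult_conv_def)

lemma prob_space_mult_conv_list:
  assumes "\<mu>s \<noteq> []" "\<And>\<mu>. \<mu> \<in> set \<mu>s \<Longrightarrow> prob_space \<mu> \<and> sets \<mu> = sets borel"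
  shows "prob_space (mult_conv_list \<mu>s) \<and> sets (mult_conv_list \<mu>s) = sets borel"
proof -
  have "prob_space (foldl mult_conv \<mu> \<nu>s) \<and> sets (foldl mult_conv \<mu> \<nu>s) = sets borel"
    if "prob_space \<mu> \<and> sets \<mu> = sets borel"
       "\<And>\<nu>. \<nu> \<in> set \<nu>s \<Longrightarrow> prob_space \<nu> \<and> sets \<nu> = sets borel" for \<mu> \<nu>s
    using that
  proof (induction \<nu>s arbitrary: \<mu>)
    case (Cons \<nu> \<nu>s)
    have "prob_space (mult_conv \<mu> \<nu>) \<and> sets (mult_conv \<mu> \<nu>) = sets borel"
      using Cons.prems(1) Cons.prems(2)[of \<nu>] by (simp add: prob_space_mult_conv sets_mult_conv)
    moreover have "prob_space \<rho> \<and> sets \<rho> = sets borel" if "\<rho> \<in> set \<nu>s" for \<rho>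
      using Cons.prems(2)[of \<rho>] that by simp
    ultimately have "prob_space (foldl mult_conv (mult_conv \<mu> \<nu>) \<nu>s) \<and>
        sets (foldl mult_conv (mult_conv \<mu> \<nu>) \<nu>s) = sets borel"
      by (rule Cons.IH)
    then show ?case
      by (simp only: foldl_Cons)
  qed (simp only: foldl_Nil)
  note * = this
  have "hd \<mu>s \<in> set \<mu>s" "\<And>\<nu>. \<nu> \<in> set (tl \<mu>s) \<Longrightarrow> \<nu> \<in> set \<mu>s"
    using assms(1) by (auto intro: list.set_sel(2))
  then show ?thesis
    unfolding mult_conv_list_def by (intro * assms(2))
qed

lemma prob_space_beta_gamma_law:
  assumes "1 \<le> length as"
    and "\<And>r. r < length as \<Longrightarrow> 0 < bs ! r \<and> bs ! r < as ! r"
    and "\<And>r. length as \<le> r \<Longrightarrow> r < length bs \<Longrightarrow> 0 < bs ! r"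
  shows "prob_space (beta_gamma_law as bs) \<and> sets (beta_gamma_law as bs) = sets borel"
  unfolding beta_gamma_law_def
proof (rule prob_space_mult_conv_list)
  show "prob_space \<mu> \<and> sets \<mu> = sets borel"
    if "\<mu> \<in> set (map (\<lambda>r. beta_law (bs ! r) (as ! r - bs ! r)) [0..<length as] @
                map (\<lambda>r. gamma_law (bs ! r) 1) [length as..<length bs])" for \<mu>
    using that assms(2,3)
    by (auto intro!: prob_space_beta_law prob_space_gamma_law simp: sets_beta_law sets_gamma_law)
qed (use assms(1) in auto)

end

theory Submission
  imports Defs
begin

text \<open>At \<open>t = -1\<close> every falling factorial is, up to the sign \<open>(-1)^n\<close>, a rising factorial
  \<open>pochhammer c n\<close>; the signs cancel because \<open>j - i\<close> is even, so the series is the quotient of the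
  products of the \<open>pochhammer (b ! r) n\<close> and the \<open>pochhammer (a ! r) n\<close>. On the other side, the
  Euler integrals give \<open>pochhammer p n / pochhammer (p + q) n\<close> for the moments of \<open>Beta(p, q)\<close> and
  \<open>pochhammer k n\<close> for those of \<open>Gamma(k, 1)\<close>, and moments are multiplicative under classical
  multiplicative convolution.\<close>

lemma falling_uminus: "falling (- c) n = (- 1) ^ n * pochhammer c n"
proof -
  have "falling (- c) n = (\<Prod>k<n. - 1 * (c + of_nat k))"
    unfolding falling_def by (intro prod.cong) auto
  then show ?thesis
    by (simp only: prod.distrib pochhammer_prod atLeast0LessThan) simp
qed

lemma falling_vec_uminus:
  "falling_vec (map ((*) (- 1)) cs) n = (- 1) ^ (n * length cs) * (\<Prod>c\<leftarrow>cs. pochhammer c n)"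
  by (induction cs) (simp_all add: falling_vec_def falling_uminus power_add mult_ac)

text \<open>The factor \<open>falling (- 1) n\<close> is \<open>(- 1) ^ n * fact n\<close>, which
  cancels both the leading sign and the factorial in the denominator. Parity makes the remaining two
  signs equal.\<close>

lemma hurwitz_series_minus_one:
  assumes "even (length bs + length as)"
  shows "hurwitz_series (- 1) bs as n =
    (\<Prod>c\<leftarrow>bs. pochhammer c n) / (\<Prod>c\<leftarrow>as. pochhammer c n)"
proof -
  have "even (length bs) = even (length as)"
    using assms by simp
  then have "(- 1 :: complex) ^ (n * length bs) = (- 1) ^ (n * length as)"
    by (simp add: minus_one_power_iff)
  then show ?thesis
    unfolding hurwitz_series_def falling_vec_uminus falling_uminus
    by (simp add: minus_one_power_iff flip: pochhammer_fact)
qed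

lemma pochhammer_pos_Gamma:
  assumes "(z::real) > 0"
  shows "pochhammer z n = Gamma (z + real n) / Gamma z"
  using assms by (intro pochhammer_Gamma) (auto elim!: nonpos_Ints_cases')

text \<open>Euler's integrals are gauge integrals; as the integrand is nonnegative, they pass
  through the nonnegative Lebesgue integral to Bochner integrals. The function \<open>h\<close> is
  the integrand \<open>g x * f x\<close> on \<open>S\<close>, to be given in a form free of the case
  distinction in the density.\<close>

lemma has_bochner_integral_density_has_integral:
  fixes f g :: "real \<Rightarrow> real"
  assumes [measurable]: "f \<in> borel_measurable borel" "g \<in> borel_measurable borel" "S \<in> sets borel"
    and g: "\<And>x. g x \<ge> 0" "\<And>x. x \<notin> S \<Longrightarrow> g x = 0"
    and h: "\<And>x. x \<in> S \<Longrightarrow> g x * f x = h x" "\<And>x. x \<in> S \<Longrightarrow> h x \<ge> 0"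
    and I: "(h has_integral I) S"
  shows "has_bochner_integral (density lborel g) f I"
proof (rule has_bochner_integral_density)
  have gf: "g x * f x = indicator S x * h x" for x
    using g(2) h(1) by (simp add: indicator_def)
  have "has_bochner_integral lborel (\<lambda>x. g x * f x) I"
  proof (rule has_bochner_integral_nn_integral)
    show "0 \<le> I"
      using has_integral_nonneg[OF I h(2)] .
    show "(\<integral>\<^sup>+ x. ennreal (g x * f x) \<partial>lborel) = ennreal I"
      unfolding gf using nn_integral_has_integral_lebesgue[OF h(2) I] .
    show "AE x in lborel. 0 \<le> g x * f x"
      unfolding gf using h(2) by (simp add: indicator_def)
  qed simp
  then show "has_bochner_integral lborel (\<lambda>x. g x *\<^sub>R f x) I"
    by simp
qed (use g in auto)

text \<open>Multiplying the density by \<open>x ^ n\<close> only shifts \<open>p\<close> to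
  \<open>p + n\<close>, so the moment is \<open>Beta (p + n) q / Beta p q\<close>.\<close>

lemma beta_law_moment:
  assumes "p > 0" "q > 0"
  shows "has_bochner_integral (beta_law p q) (\<lambda>x. x ^ n) (pochhammer p n / pochhammer (p + q) n)"
  unfolding beta_law_def
proof (rule has_bochner_integral_density_has_integral)
  have G: "Gamma p > 0" "Gamma q > 0" "Gamma (p + q) > 0"
    using assms by (simp_all add: Gamma_real_pos)
  then have B: "Beta p q > 0"
    by (simp add: Beta_def)
  show "0 \<le> (if 0 < x \<and> x < 1 then x powr (p - 1) * (1 - x) powr (q - 1) / Beta p q else 0)" for x
    using B by simp
  show "(if 0 < x \<and> x < 1 then x powr (p - 1) * (1 - x) powr (q - 1) / Beta p q else 0) * x ^ n
      = x powr (p + n - 1) * (1 - x) powr (q - 1) / Beta p q" if "x \<in> {0<..<1}" for x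
    using that by (simp add: powr_realpow[symmetric] powr_add[symmetric] algebra_simps)
  show "0 \<le> x powr (p + n - 1) * (1 - x) powr (q - 1) / Beta p q" for x
    using B by simp
  \<comment> \<open>\<open>Gamma q\<close> cancels, leaving \<open>Gamma (p + n) / Gamma p\<close>
    over the same quotient at \<open>p + q\<close>.\<close>
  have "Beta (p + n) q / Beta p q = pochhammer p n / pochhammer (p + q) n"
    using assms G less_imp_neq[OF G(2)] by (simp add: pochhammer_pos_Gamma Beta_def add_ac)
  then show "((\<lambda>x. x powr (p + n - 1) * (1 - x) powr (q - 1) / Beta p q)
      has_integral pochhammer p n / pochhammer (p + q) n) {0<..<1}"
    using has_integral_divide[OF has_integral_Beta_real[of "p + n" q], of "Beta p q"] assms
    by (simp add: has_integral_Icc_iff_Ioo)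
qed auto

text \<open>Here \<open>x ^ n\<close> shifts \<open>k\<close> to \<open>k + n\<close>, giving
  \<open>Gamma (k + n) / Gamma k\<close>.\<close>

lemma gamma_law_moment:
  assumes "k > 0"
  shows "has_bochner_integral (gamma_law k 1) (\<lambda>x. x ^ n) (pochhammer k n)"
  unfolding gamma_law_def
proof (rule has_bochner_integral_density_has_integral)
  have G: "Gamma k > 0"
    using assms by (rule Gamma_real_pos)
  show "0 \<le> (if 0 < x then x powr (k - 1) * exp (- x / 1) / (Gamma k * 1 powr k) else 0)" for x
    using G by simp
  show "(if 0 < x then x powr (k - 1) * exp (- x / 1) / (Gamma k * 1 powr k) else 0) * x ^ n
      = x powr (k + n - 1) / exp x / Gamma k" if "x \<in> {0..}" for x
  \<comment> \<open>At the endpoint 0 of the Gamma integral the density is 0 by definition, and the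
    right-hand side is 0 because \<open>0 powr s = 0\<close>.\<close>
  proof (cases "x = 0")
    case False
    then have "x powr (k + n - 1) = x powr (k - 1) * x ^ n"
      using that by (simp add: powr_realpow[symmetric] powr_add[symmetric] algebra_simps)
    then show ?thesis
      using False that by (simp add: exp_minus field_simps)
  qed simp
  show "0 \<le> x powr (k + n - 1) / exp x / Gamma k" for x
    using G by simp
  show "((\<lambda>x. x powr (k + n - 1) / exp x / Gamma k) has_integral pochhammer k n) {0..}"
    using has_integral_divide[OF Gamma_integral_real[of "k + n"], of "Gamma k"] assms
    by (simp add: pochhammer_pos_Gamma)
qed auto

text \<open>Since \<open>(x * y) ^ n = x ^ n * y ^ n\<close>, Fubini splits the moment over the
  product measure into two factors.\<close>

lemma mult_conv_moment:
  assumes "prob_space \<mu>" "prob_space \<nu>" and [measurable_cong]: "sets \<mu> = sets borel" "sets \<nu> = sets borel"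
    and m: "has_bochner_integral \<mu> (\<lambda>x. x ^ n) u" "has_bochner_integral \<nu> (\<lambda>x. x ^ n) v"
  shows "has_bochner_integral (mult_conv \<mu> \<nu>) (\<lambda>x. x ^ n) (u * v)"
proof -
  interpret \<mu>: prob_space \<mu> by fact
  interpret \<nu>: prob_space \<nu> by fact
  interpret pair_prob_space \<mu> \<nu> ..
  have i: "integrable \<mu> (\<lambda>x. x ^ n)" "integrable \<nu> (\<lambda>x. x ^ n)"
    and e: "(\<integral>x. x ^ n \<partial>\<mu>) = u" "(\<integral>x. x ^ n \<partial>\<nu>) = v"
    using m by (auto simp: has_bochner_integral_iff)
  have int: "integrable (\<mu> \<Otimes>\<^sub>M \<nu>) (\<lambda>(x, y). x ^ n * y ^ n)"
  proof (rule Fubini_integrable)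
    \<comment> \<open>The inner integral is a constant, the absolute \<open>n\<close>-th moment of
      \<open>\<nu>\<close>, times \<open>\<bar>x\<bar> ^ n\<close>.\<close>
    show "integrable \<mu> (\<lambda>x. \<integral>y. norm (case (x, y) of (x, y) \<Rightarrow> x ^ n * y ^ n) \<partial>\<nu>)"
      using integrable_norm[OF i(1)] by (simp add: abs_mult)
    show "AE x in \<mu>. integrable \<nu> (\<lambda>y. case (x, y) of (x, y) \<Rightarrow> x ^ n * y ^ n)"
      using i(2) by simp
  qed measurable
  have "has_bochner_integral (\<mu> \<Otimes>\<^sub>M \<nu>) (\<lambda>(x, y). x ^ n * y ^ n) (u * v)"
    using int integral_fst'[OF int] i by (simp add: has_bochner_integral_iff e)
  then show ?thesis
    unfolding mult_conv_def
    by (intro has_bochner_integral_distr) (simp_all add: case_prod_beta' power_mult_distrib)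
qed

text \<open>\<open>foldl\<close> brackets to the left, so appending a law adds the outermost
  convolution; hence the induction from the end of the list.\<close>

lemma mult_conv_list_moment:
  assumes "\<mu>s \<noteq> []"
    and "\<And>\<mu>. \<mu> \<in> set \<mu>s \<Longrightarrow> prob_space \<mu> \<and> sets \<mu> = sets borel"
    and "\<And>\<mu>. \<mu> \<in> set \<mu>s \<Longrightarrow> has_bochner_integral \<mu> (\<lambda>x. x ^ n) (m \<mu>)"
  shows "has_bochner_integral (mult_conv_list \<mu>s) (\<lambda>x. x ^ n) (\<Prod>\<mu>\<leftarrow>\<mu>s. m \<mu>)"
  using assms
proof (induction \<mu>s rule: rev_nonempty_induct)
  case (single \<mu>)
  then show ?case
    by (simp add: mult_conv_list_def)
next
  case (snoc \<nu> \<mu>s)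
  have "mult_conv_list (\<mu>s @ [\<nu>]) = mult_conv (mult_conv_list \<mu>s) \<nu>"
    using snoc.hyps by (simp add: mult_conv_list_def)
  moreover have "prob_space (mult_conv_list \<mu>s) \<and> sets (mult_conv_list \<mu>s) = sets borel"
    using snoc.hyps snoc.prems(1) by (intro prob_space_mult_conv_list) auto
  moreover have "has_bochner_integral (mult_conv_list \<mu>s) (\<lambda>x. x ^ n) (\<Prod>\<mu>\<leftarrow>\<mu>s. m \<mu>)"
    using snoc.prems by (intro snoc.IH) auto
  ultimately show ?case
    using snoc.prems[of \<nu>] by (simp add: mult_conv_moment)
qed

lemma beta_gamma_law_moment:
  assumes "1 \<le> length as" and "length as \<le> length bs"
    and beta: "\<And>r. r < length as \<Longrightarrow> 0 < bs ! r \<and> bs ! r < as ! r"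
    and gamma: "\<And>r. length as \<le> r \<Longrightarrow> r < length bs \<Longrightarrow> 0 < bs ! r"
  shows "has_bochner_integral (beta_gamma_law as bs) (\<lambda>x. x ^ n)
    ((\<Prod>c\<leftarrow>bs. pochhammer c n) / (\<Prod>c\<leftarrow>as. pochhammer c n))"
proof -
  let ?i = "length as" and ?j = "length bs"
  let ?\<beta> = "\<lambda>r. beta_law (bs ! r) (as ! r - bs ! r)" and ?\<gamma> = "\<lambda>r. gamma_law (bs ! r) 1"
  let ?P = "\<lambda>cs r. pochhammer (cs ! r :: real) n"
  \<comment> \<open>The two Beta parameters add up to \<open>as ! r\<close>, which yields the
    denominator.\<close>
  have \<beta>: "has_bochner_integral (?\<beta> r) (\<lambda>x. x ^ n) (?P bs r / ?P as r)" if "r < ?i" for r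
    using beta_law_moment[of "bs ! r" "as ! r - bs ! r" n] beta[OF that] by simp
  have \<gamma>: "has_bochner_integral (?\<gamma> r) (\<lambda>x. x ^ n) (?P bs r)" if "?i \<le> r" "r < ?j" for r
    using gamma_law_moment gamma[OF that] .
  have upt: "(\<Prod>r\<leftarrow>[k..<l]. f r) = (\<Prod>r = k..<l. f r)" for k l and f :: "nat \<Rightarrow> real"
    using prod.distinct_set_conv_list[of "[k..<l]" f] by simp
  have nth: "(\<Prod>c\<leftarrow>cs. pochhammer c n) = (\<Prod>r = 0..<length cs. ?P cs r)" for cs
    using prod.list_conv_set_nth[of "map (\<lambda>c. pochhammer c n) cs"] by simp
  let ?\<mu>s = "map ?\<beta> [0..<?i] @ map ?\<gamma> [?i..<?j]"
  \<comment> \<open>\<open>mult_conv_list_moment\<close> takes the moment as a function of the law,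
    not of the index, so the integral itself is used; the closed forms enter once the product is
    split by index.\<close>
  have "has_bochner_integral (mult_conv_list ?\<mu>s) (\<lambda>x. x ^ n) (\<Prod>\<mu>\<leftarrow>?\<mu>s. \<integral>x. x ^ n \<partial>\<mu>)"
  proof (rule mult_conv_list_moment)
    show "prob_space \<mu> \<and> sets \<mu> = sets borel" if "\<mu> \<in> set ?\<mu>s" for \<mu>
      using that beta gamma
      by (auto intro!: prob_space_beta_law prob_space_gamma_law simp: sets_beta_law sets_gamma_law)
    show "has_bochner_integral \<mu> (\<lambda>x. x ^ n) (\<integral>x. x ^ n \<partial>\<mu>)" if "\<mu> \<in> set ?\<mu>s" for \<mu>
      using that \<beta> \<gamma> by (auto simp: has_bochner_integral_iff)
  qed (use assms(1) in auto)
  also have "(\<Prod>\<mu>\<leftarrow>?\<mu>s. \<integral>x. x ^ n \<partial>\<mu>)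
      = (\<Prod>r = 0..<?i. \<integral>x. x ^ n \<partial>?\<beta> r) * (\<Prod>r = ?i..<?j. \<integral>x. x ^ n \<partial>?\<gamma> r)"
    by (simp add: upt comp_def)
  also have "\<dots> = (\<Prod>r = 0..<?i. ?P bs r / ?P as r) * (\<Prod>r = ?i..<?j. ?P bs r)"
    using \<beta> \<gamma> by (intro arg_cong2[where f = "(*)"] prod.cong) (auto simp: has_bochner_integral_iff)
  \<comment> \<open>The numerators over \<open>0..<?i\<close> and \<open>?i..<?j\<close> join into
    one product.\<close>
  also have "\<dots> = (\<Prod>r = 0..<?j. ?P bs r) / (\<Prod>r = 0..<?i. ?P as r)"
    using prod.atLeastLessThan_concat[of 0 ?i ?j "?P bs"] assms(2)
    by (simp add: prod_dividef)
  finally show ?thesis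
    by (simp only: beta_gamma_law_def nth)
qed

theorem proposition4p2:
  fixes i j :: nat and a b :: "real list"
    and M :: "'m measure" and X :: "'m \<Rightarrow> real"
  assumes "1 \<le> i" and "i \<le> j" and "even (j - i)"
    and "length a = i" and "length b = j"
    and "\<And>r. r < i \<Longrightarrow> 0 < b ! r \<and> b ! r < a ! r"
    and "\<And>r. i \<le> r \<Longrightarrow> r < j \<Longrightarrow> 0 < b ! r"
    and "prob_space M" and "X \<in> borel_measurable M"
    and "distr M borel X = beta_gamma_law a b"
  shows "has_all_moments M X \<and>
    hurwitz_series (- 1) (map complex_of_real b) (map complex_of_real a) = moment_seq M X"
proof -
  have moment: "has_bochner_integral M (\<lambda>\<omega>. X \<omega> ^ n)
      ((\<Prod>c\<leftarrow>b. pochhammer c n) / (\<Prod>c\<leftarrow>a. pochhammer c n))" for n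
  proof -
    have "has_bochner_integral (distr M borel X) (\<lambda>x. x ^ n)
        ((\<Prod>c\<leftarrow>b. pochhammer c n) / (\<Prod>c\<leftarrow>a. pochhammer c n))"
      unfolding assms(10) using assms by (intro beta_gamma_law_moment) auto
    then show ?thesis
      using assms(9) by (simp add: has_bochner_integral_iff integrable_distr_eq integral_distr)
  qed
  \<comment> \<open>As \<open>i \<le> j\<close>, the subtraction is not truncated and
    \<open>j + i = (j - i) + 2 * i\<close>.\<close>
  have "even (length b + length a)"
    using assms(2-5) by simp
  moreover have "(\<Prod>c\<leftarrow>map complex_of_real cs. pochhammer c n)
      = complex_of_real (\<Prod>c\<leftarrow>cs. pochhammer c n)" for cs n
    by (induction cs) (simp_all add: pochhammer_of_real)
  ultimately have "hurwitz_series (- 1) (map complex_of_real b) (map complex_of_real a) n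
      = moment_seq M X n" for n
    \<comment> \<open>Without \<open>map_map\<close> the nested \<open>map\<close> keeps the shape
      to which the equation for the cast applies.\<close>
    using moment[of n]
    by (simp add: hurwitz_series_minus_one moment_seq_def has_bochner_integral_iff del: map_map)
  then show ?thesis
    using moment by (auto simp: has_all_moments_def has_bochner_integral_iff)
qed

end
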